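(* Let $\alpha>0$. Then the algorithm PC2 (defined in the context) is unconditionally well-posed for any input $\boldsymbol m_h^0\in\boldsymbol{\mathcal{M}}_h$, i.e., for all $\ell=0,\dots,L-1$, the predictor problem admits a unique solution $\boldsymbol v_h^\ell\in\mathcal{S}^1(\mathcal{T}_h)^3$, and the corrector problem admits a unique solution $\boldsymbol m_h^{\ell+1}\in\boldsymbol{\mathcal{M}}_h$.
   Context: **Setting.** $\Omega\subset\mathbb{R}^3$ is a bounded Lipschitz domain with a regular (conforming) tetrahedral triangulation $\mathcal{T}_h$ of mesh size $h>0$; $\mathcal{N}_h$ is the set of vertices of $\mathcal{T}_h$. $T>0$, $L\in\mathbb{N}$, $k:=T/L>0$ is the uniform time-step size. $\alpha\ge 0$ (damping), $\ell_{\mathrm{ex}}>0$ (exchange length), $\theta\in[0,1]$ are constants. $\times$ is the cross product and $\cdot$ the scalar product in $\mathbb{R}^3$, $|\cdot|$ the Euclidean norm. **Discrete spaces.** $\mathcal{S}^1(\mathcal{T}_h)$ is the space of $\mathcal{T}_h$-piecewise linear, globally continuous functions $\overline\Omega\to\mathbb{R}$, with nodal basis $\{\phi_{\boldsymbol z}\}_{\boldsymbol z\in\mathcal{N}_h}$, $\phi_{\boldsymbol z}(\boldsymbol z')=\delta_{\boldsymbol z,\boldsymbol z'}$. Set $$\boldsymbol{\mathcal{M}}_h:=\{\boldsymbol m_h\in\mathcal{S}^1(\mathcal{T}_h)^3:\ |\boldsymbol m_h(\boldsymbol z)|=1\ \text{for all }\boldsymbol z\in\mathcal{N}_h\}.$$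 **Mass-lumped product.** For continuous $\boldsymbol u,\boldsymbol w:\overline\Omega\to\mathbb{R}^3$, $$\langle\boldsymbol u,\boldsymbol w\rangle_h:=\sum_{\boldsymbol z\in\mathcal{N}_h}\beta_{\boldsymbol z}\,\boldsymbol u(\boldsymbol z)\cdot\boldsymbol w(\boldsymbol z),\qquad \beta_{\boldsymbol z}:=\int_\Omega\phi_{\boldsymbol z}\,d\boldsymbol x>0$$ (equivalently, the integral over $\Omega$ of the nodal interpolant of $\boldsymbol u\cdot\boldsymbol w$). $\langle\cdot,\cdot\rangle$ is the $L^2(\Omega)$-scalar product (for vector- or matrix-valued functions). **Discrete Laplacian.** For $\boldsymbol w\in H^1(\Omega;\mathbb{R}^3)$, $\boldsymbol\Delta_h\boldsymbol w\in\mathcal{S}^1(\mathcal{T}_h)^3$ is the unique function with $-\langle\boldsymbol\Delta_h\boldsymbol w,\boldsymbol w_h\rangle_h=\langle\nabla\boldsymbol w,\nabla\boldsymbol w_h\rangle$ for all $\boldsymbol w_h\in\mathcal{S}^1(\mathcal{T}_h)^3$. **Notation.** $\boldsymbol m_h^{\ell+1/2}:=(\boldsymbol m_h^{\ell+1}+\boldsymbol m_h^\ell)/2$ and $d_t\boldsymbol m_h^{\ell+1}:=(\boldsymbol m_h^{\ell+1}-\boldsymbol m_h^\ell)/k$. **Algorithm PC2.** Input $\boldsymbol m_h^0\in\boldsymbol{\mathcal{M}}_h$. For $\ell=0,\dots,L-1$: (i) Predictor: compute $\boldsymbol v_h^\ell\in\mathcal{S}^1(\mathcal{T}_h)^3$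 such that, for all $\boldsymbol w_h\in\mathcal{S}^1(\mathcal{T}_h)^3$, $$(1+\alpha^2)\langle\boldsymbol v_h^\ell,\boldsymbol w_h\rangle_h=-\ell_{\mathrm{ex}}^2\langle\boldsymbol m_h^\ell\times\boldsymbol\Delta_h(\boldsymbol m_h^\ell+\theta k\boldsymbol v_h^\ell),\boldsymbol w_h\rangle_h-\alpha\ell_{\mathrm{ex}}^2\langle\boldsymbol m_h^\ell\times(\boldsymbol m_h^\ell\times\boldsymbol\Delta_h(\boldsymbol m_h^\ell+\theta k\boldsymbol v_h^\ell)),\boldsymbol w_h\rangle_h.$$ (ii) Corrector: compute $\boldsymbol m_h^{\ell+1}\in\boldsymbol{\mathcal{M}}_h$ such that, for all $\boldsymbol w_h\in\mathcal{S}^1(\mathcal{T}_h)^3$, $$\begin{aligned}(1+\alpha^2)\langle d_t\boldsymbol m_h^{\ell+1},\boldsymbol w_h\rangle_h&=-\ell_{\mathrm{ex}}^2\langle\boldsymbol m_h^{\ell+1/2}\times\boldsymbol\Delta_h(\boldsymbol m_h^\ell+(k/2)\boldsymbol v_h^\ell),\boldsymbol w_h\rangle_h\\&\quad-\alpha\ell_{\mathrm{ex}}^2\langle\boldsymbol m_h^{\ell+1/2}\times[(\boldsymbol m_h^\ell+(k/2)\boldsymbol v_h^\ell)\times\boldsymbol\Delta_h(\boldsymbol m_h^\ell+(k/2)\boldsymbol v_h^\ell)],\boldsymbol w_h\rangle_h.\end{aligned}$$ *)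

theory Defs
  imports "HOL-Analysis.Analysis"
begin

unbundle cross3_syntax

text \<open>
  Lipschitz domain: after a rigid change of coordinates, near each boundary point the set is the
  strict epigraph of a Lipschitz function of the first two coordinates.
\<close>

definition lipschitz_domain :: "(real^3) set \<Rightarrow> bool" where
  "lipschitz_domain \<Omega> \<longleftrightarrow>
     open \<Omega> \<and> connected \<Omega> \<and> \<Omega> \<noteq> {} \<and>
     (\<forall>p\<in>frontier \<Omega>. \<exists>r>0. \<exists>(Q :: real^3 \<Rightarrow> real^3) (\<gamma> :: real \<times> real \<Rightarrow> real) C.
        orthogonal_transformation Q \<and> C-lipschitz_on UNIV \<gamma> \<and>
        \<Omega> \<inter> ball p r = {x \<in> ball p r. \<gamma> (Q x $ 1, Q x $ 2) < Q x $ 3})"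

text \<open>
  The library notion \<^const>\<open>triangulation\<close> already says that the family is finite and that any two
  members meet in a common (possibly empty) face, i.e. that the mesh is conforming.
\<close>

definition tetrahedral_triangulation :: "(real^3) set \<Rightarrow> (real^3) set set \<Rightarrow> bool" where
  "tetrahedral_triangulation \<Omega> \<T> \<longleftrightarrow>
     triangulation \<T> \<and> (\<forall>K\<in>\<T>. 3 simplex K) \<and> \<Union>\<T> = closure \<Omega>"

definition mesh_size :: "(real^3) set set \<Rightarrow> real" where
  "mesh_size \<T> = Max (diameter ` \<T>)"

definition nodes :: "(real^3) set set \<Rightarrow> (real^3) set" where
  "nodes \<T> = {z. \<exists>K\<in>\<T>. z extreme_point_of K}"

text \<open>
  A finite element function on the closure of \<open>\<Omega>\<close> is represented by its extension by zero to the
  whole space. This makes the spaces below closed under pointwise linear combinations and makes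
  equality of functions on the closure the same as equality in HOL, so that unique existence has
  its intended meaning.
\<close>

definition S1 :: "(real^3) set \<Rightarrow> (real^3) set set \<Rightarrow> (real^3 \<Rightarrow> real) set" where
  "S1 \<Omega> \<T> = {f. continuous_on (closure \<Omega>) f \<and>
                (\<forall>K\<in>\<T>. \<exists>a b. \<forall>x\<in>K. f x = a \<bullet> x + b) \<and>
                (\<forall>x. x \<notin> closure \<Omega> \<longrightarrow> f x = 0)}"

definition S1_vec :: "(real^3) set \<Rightarrow> (real^3) set set \<Rightarrow> (real^3 \<Rightarrow> real^3) set" where
  "S1_vec \<Omega> \<T> = {u. \<forall>i. (\<lambda>x. u x $ i) \<in> S1 \<Omega> \<T>}"

definition M_h :: "(real^3) set \<Rightarrow> (real^3) set set \<Rightarrow> (real^3 \<Rightarrow> real^3) set" where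
  "M_h \<Omega> \<T> = {m \<in> S1_vec \<Omega> \<T>. \<forall>z\<in>nodes \<T>. norm (m z) = 1}"

definition nodal_basis ::
  "(real^3) set \<Rightarrow> (real^3) set set \<Rightarrow> real^3 \<Rightarrow> real^3 \<Rightarrow> real" where
  "nodal_basis \<Omega> \<T> z =
     (THE \<phi>. \<phi> \<in> S1 \<Omega> \<T> \<and> (\<forall>z'\<in>nodes \<T>. \<phi> z' = (if z' = z then 1 else 0)))"

definition nodal_weight :: "(real^3) set \<Rightarrow> (real^3) set set \<Rightarrow> real^3 \<Rightarrow> real" where
  "nodal_weight \<Omega> \<T> z = (LINT x:\<Omega>|lebesgue. nodal_basis \<Omega> \<T> z x)"

definition lumped ::
  "(real^3) set \<Rightarrow> (real^3) set set \<Rightarrow> (real^3 \<Rightarrow> real^3) \<Rightarrow> (real^3 \<Rightarrow> real^3) \<Rightarrow> real" where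
  "lumped \<Omega> \<T> u w = (\<Sum>z\<in>nodes \<T>. nodal_weight \<Omega> \<T> z * (u z \<bullet> w z))"

text \<open>For matrix-valued functions, \<open>\<bullet>\<close> is the Frobenius product.\<close>

definition L2_prod ::
  "(real^3) set \<Rightarrow> (real^3 \<Rightarrow> 'b::euclidean_space) \<Rightarrow> (real^3 \<Rightarrow> 'b) \<Rightarrow> real" where
  "L2_prod \<Omega> F G = (LINT x:\<Omega>|lebesgue. F x \<bullet> G x)"

text \<open>
  The gradient is only used for functions in \<^const>\<open>S1_vec\<close>. Their weak gradient is the classical
  Jacobian, which exists in the interior of every tetrahedron, hence almost everywhere in \<open>\<Omega>\<close>. On
  the element faces, a Lebesgue null set, the value is unspecified; integrals with respect to the
  complete measure \<^const>\<open>lebesgue\<close> do not depend on it.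
\<close>

definition grad :: "(real^3 \<Rightarrow> real^3) \<Rightarrow> real^3 \<Rightarrow> real^3^3" where
  "grad u x = jacobian u (at x)"

definition discrete_laplacian ::
  "(real^3) set \<Rightarrow> (real^3) set set \<Rightarrow> (real^3 \<Rightarrow> real^3) \<Rightarrow> real^3 \<Rightarrow> real^3" where
  "discrete_laplacian \<Omega> \<T> w =
     (THE d. d \<in> S1_vec \<Omega> \<T> \<and>
        (\<forall>w\<^sub>h\<in>S1_vec \<Omega> \<T>. - lumped \<Omega> \<T> d w\<^sub>h = L2_prod \<Omega> (grad w) (grad w\<^sub>h)))"

text \<open>In the following, \<open>l_ex\<close> is the exchange length, \<open>m\<close> the current iterate,
  \<open>v\<close> the predictor and \<open>m'\<close> the next iterate.\<close>

definition predictor ::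
  "(real^3) set \<Rightarrow> (real^3) set set \<Rightarrow> real \<Rightarrow> real \<Rightarrow> real \<Rightarrow> real \<Rightarrow>
   (real^3 \<Rightarrow> real^3) \<Rightarrow> (real^3 \<Rightarrow> real^3) \<Rightarrow> bool" where
  "predictor \<Omega> \<T> \<alpha> l_ex \<theta> k m v \<longleftrightarrow>
     v \<in> S1_vec \<Omega> \<T> \<and>
     (\<forall>w\<in>S1_vec \<Omega> \<T>.
        let H = discrete_laplacian \<Omega> \<T> (\<lambda>x. m x + (\<theta> * k) *\<^sub>R v x) in
        (1 + \<alpha>\<^sup>2) * lumped \<Omega> \<T> v w =
          - l_ex\<^sup>2 * lumped \<Omega> \<T> (\<lambda>x. m x \<times> H x) w
          - \<alpha> * l_ex\<^sup>2 * lumped \<Omega> \<T> (\<lambda>x. m x \<times> (m x \<times> H x)) w)"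

definition corrector ::
  "(real^3) set \<Rightarrow> (real^3) set set \<Rightarrow> real \<Rightarrow> real \<Rightarrow> real \<Rightarrow>
   (real^3 \<Rightarrow> real^3) \<Rightarrow> (real^3 \<Rightarrow> real^3) \<Rightarrow> (real^3 \<Rightarrow> real^3) \<Rightarrow> bool" where
  "corrector \<Omega> \<T> \<alpha> l_ex k m v m' \<longleftrightarrow>
     m' \<in> M_h \<Omega> \<T> \<and>
     (\<forall>w\<in>S1_vec \<Omega> \<T>.
        let dt_m = (\<lambda>x. (m' x - m x) /\<^sub>R k);
            m_mid = (\<lambda>x. (m' x + m x) /\<^sub>R 2);
            m_pred = (\<lambda>x. m x + (k / 2) *\<^sub>R v x);
            H = discrete_laplacian \<Omega> \<T> m_pred in
        (1 + \<alpha>\<^sup>2) * lumped \<Omega> \<T> dt_m w =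
          - l_ex\<^sup>2 * lumped \<Omega> \<T> (\<lambda>x. m_mid x \<times> H x) w
          - \<alpha> * l_ex\<^sup>2 * lumped \<Omega> \<T> (\<lambda>x. m_mid x \<times> (m_pred x \<times> H x)) w)"

text \<open>The sequences \<open>m\<close> and \<open>v\<close> arise from \<open>n\<close> steps of the algorithm with input \<open>m0\<close>; only
  \<open>m 0, \<dots>, m n\<close> and \<open>v 0, \<dots>, v (n - 1)\<close> are constrained.\<close>

definition PC2_steps ::
  "(real^3) set \<Rightarrow> (real^3) set set \<Rightarrow> real \<Rightarrow> real \<Rightarrow> real \<Rightarrow> real \<Rightarrow> (real^3 \<Rightarrow> real^3) \<Rightarrow>
   nat \<Rightarrow> (nat \<Rightarrow> real^3 \<Rightarrow> real^3) \<Rightarrow> (nat \<Rightarrow> real^3 \<Rightarrow> real^3) \<Rightarrow> bool" where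
  "PC2_steps \<Omega> \<T> \<alpha> l_ex \<theta> k m0 n m v \<longleftrightarrow>
     m 0 = m0 \<and>
     (\<forall>j<n. predictor \<Omega> \<T> \<alpha> l_ex \<theta> k (m j) (v j) \<and>
            corrector \<Omega> \<T> \<alpha> l_ex k (m j) (v j) (m (Suc j)))"

end

theory Submission
  imports Defs "HOL-Library.Function_Algebras"
begin

unbundle cross3_syntax

text \<open>
  Since the nodal weights are positive, mass lumping decouples both variational problems into
  equations at the nodes. The predictor problem is linear, so it suffices to show that its
  homogeneous version has only the trivial solution \<open>v\<close>. Put \<open>H = \<Delta>\<^sub>h (\<theta> k v)\<close>. Taking the scalar
  product of the nodal equation with \<open>H\<close> leaves
  \<open>(1 + \<alpha>\<^sup>2) v \<bullet> H = \<alpha> l\<^sup>2 \<bar>m \<times> H\<bar>\<^sup>2\<close> (where \<open>l\<close> is the exchange length), whereas the weighted sum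
  of \<open>v \<bullet> H\<close> over the nodes equals \<open>- \<theta> k \<parallel>\<nabla>v\<parallel>\<^sup>2 \<le> 0\<close>. As \<open>\<alpha> > 0\<close>, \<open>m \<times> H\<close> vanishes at all nodes,
  and hence so does \<open>v\<close>. The corrector equation reads \<open>m' - m = (m' + m) \<times> g\<close> at every node,
  with \<open>g\<close> known: a Cayley transform, which is uniquely solvable and preserves the length.
\<close>

subsection \<open>Preliminaries\<close>

text \<open>Turns uniqueness for the nodal predictor equation into existence. Functions vanishing
  off the finite set \<open>N\<close> form a finite-dimensional space that \<open>F\<close> maps
  into itself, so injectivity there forces surjectivity. The count takes place in the full function
  space under pointwise operations.\<close>

lemma finite_support_surj:
  fixes F :: "('a \<Rightarrow> 'b::euclidean_space) \<Rightarrow> 'a \<Rightarrow> 'b"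
  assumes N: "finite N"
    and add: "\<And>f g. F (\<lambda>x. f x + g x) = (\<lambda>x. F f x + F g x)"
    and scale: "\<And>c f. F (\<lambda>x. c *\<^sub>R f x) = (\<lambda>x. c *\<^sub>R F f x)"
    and supp: "\<And>f x. x \<notin> N \<Longrightarrow> F f x = 0"
    and inj: "\<And>f. (\<And>x. x \<notin> N \<Longrightarrow> f x = 0) \<Longrightarrow> F f = (\<lambda>_. 0) \<Longrightarrow> f = (\<lambda>_. 0)"
    and r: "\<And>x. x \<notin> N \<Longrightarrow> r x = 0"
  shows "\<exists>f. F f = r"
proof -
  let ?s = "\<lambda>(c::real) (f::'a \<Rightarrow> 'b) x. c *\<^sub>R f x"
  interpret V: vector_space ?s
    by unfold_locales (auto simp: fun_eq_iff algebra_simps)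
  interpret P: vector_space_pair ?s ?s ..
  have lin: "Vector_Spaces.linear ?s ?s F"
    by unfold_locales (auto simp: plus_fun_def add scale)
  define S where "S = {f::'a \<Rightarrow> 'b. \<forall>x. x \<notin> N \<longrightarrow> f x = 0}"
  \<comment> \<open>Point masses: \<open>e (z, b)\<close> takes the value \<open>b\<close> at
    \<open>z\<close> and 0 elsewhere. With \<open>z\<close> in \<open>N\<close> and \<open>b\<close>
    in \<open>Basis\<close> they are finitely many and span \<open>S\<close>.\<close>
  define e where "e = (\<lambda>(z::'a, b::'b) x. if x = z then b else 0)"
  have subS: "V.subspace S"
    by (auto simp: V.subspace_def S_def)
  have S_span: "S \<subseteq> V.span (e ` (Sigma N (\<lambda>_. Basis)))"
  proof
    fix f assume f: "f \<in> S"
    have "f = (\<Sum>p\<in>Sigma N (\<lambda>_. Basis). ?s (f (fst p) \<bullet> snd p) (e p))"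
    proof
      fix x
      have "(\<Sum>p\<in>Sigma N (\<lambda>_. Basis). ?s (f (fst p) \<bullet> snd p) (e p)) x
          = (\<Sum>p\<in>Sigma N (\<lambda>_. Basis). (f (fst p) \<bullet> snd p) *\<^sub>R e p x)"
        by (induction rule: infinite_finite_induct) auto
      also have "\<dots> = (\<Sum>z\<in>N. \<Sum>b\<in>Basis. (f z \<bullet> b) *\<^sub>R (if x = z then b else 0))"
        by (simp add: sum.cartesian_product e_def case_prod_unfold)
      also have "\<dots> = (\<Sum>z\<in>N. if x = z then f z else 0)"
        by (intro sum.cong refl) (auto simp: euclidean_representation)
      also have "\<dots> = f x"
        using f N by (auto simp: S_def)
      finally show "f x = (\<Sum>p\<in>Sigma N (\<lambda>_. Basis). ?s (f (fst p) \<bullet> snd p) (e p)) x" by simp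
    qed
    also have "\<dots> \<in> V.span (e ` (Sigma N (\<lambda>_. Basis)))"
      by (intro V.span_sum V.span_scale V.span_base) auto
    finally show "f \<in> V.span (e ` (Sigma N (\<lambda>_. Basis)))" .
  qed
  obtain C where C: "C \<subseteq> S" "V.independent C" "S \<subseteq> V.span C"
    using V.maximal_independent_subset by blast
  have spanC: "V.span C = S"
    using C V.span_minimal[OF C(1) subS] by blast
  have finC: "finite C"
    using V.independent_span_bound[of "e ` (Sigma N (\<lambda>_. Basis))" C] N C S_span by auto
  interpret F: Vector_Spaces.linear ?s ?s F by (rule lin)
  have injC: "inj_on F (V.span C)"
    using inj by (subst F.inj_on_iff_eq_0[OF V.subspace_span])
      (auto simp: spanC S_def zero_fun_def)
  have indF: "V.independent (F ` C)"
    by (rule F.independent_injective_image[OF C(2) injC])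
  have sub: "F ` C \<subseteq> S" using supp by (auto simp: S_def)
  have "r \<in> V.span (F ` C)"
  proof (rule ccontr)
    \<comment> \<open>Otherwise \<open>r\<close> together with the image of the basis
      \<open>C\<close> would be an independent set of \<open>card C + 1\<close> vectors inside the
      span of \<open>C\<close>.\<close>
    assume r': "r \<notin> V.span (F ` C)"
    then have "V.independent (insert r (F ` C))"
      using indF by (simp add: V.independent_insert)
    moreover have "insert r (F ` C) \<subseteq> V.span C"
      using sub r by (auto simp: spanC S_def)
    ultimately have "card (insert r (F ` C)) \<le> card C"
      using V.independent_span_bound[OF finC] by blast
    moreover have "r \<notin> F ` C" using r' V.span_base by blast
    moreover have "card (F ` C) = card C"
      by (meson V.span_superset card_image inj_on_subset injC)
    ultimately show False using finC by simp
  qed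
  then show ?thesis by (auto simp: F.span_image)
qed

section \<open>Affine functions on simplices\<close>

text \<open>Moving one vertex \<open>p\<close> to the origin makes the other vertices linearly
  independent, so a linear functional can take any values on them. The constant term then fixes the
  value at \<open>p\<close>.\<close>

lemma affine_interpolation:
  fixes C :: "'a::euclidean_space set" and c :: "'a \<Rightarrow> real"
  assumes "\<not> affine_dependent C"
  shows "\<exists>a b. \<forall>x\<in>C. a \<bullet> x + b = c x"
proof (cases "C = {}")
  case False
  then obtain p where p: "p \<in> C" by blast
  have "independent ((\<lambda>x. -p + x) ` (C - {p}))"
    using assms affine_dependent_iff_dependent2[OF p] by simp
  then obtain g :: "'a \<Rightarrow> real" where g: "linear g" and
    gv: "\<forall>y\<in>(\<lambda>x. -p + x) ` (C - {p}). g y = c (y + p) - c p"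
    using linear_independent_extend[of _ "\<lambda>y. c (y + p) - c p"] by blast
  have rep: "g y = adjoint g 1 \<bullet> y" for y
    using adjoint_works[OF g, of y 1] by (simp add: inner_commute)
  have "adjoint g 1 \<bullet> x + (c p - adjoint g 1 \<bullet> p) = c x" if "x \<in> C" for x
  proof (cases "x = p")
    case False
    then have "g (-p + x) = c x - c p" using gv that by auto
    then show ?thesis by (simp add: rep inner_simps)
  qed simp
  then show ?thesis by blast
qed simp

text \<open>The set where two affine functions agree is convex, so it contains the hull as soon as
  it contains \<open>C\<close>.\<close>

lemma affine_eq_on_convex_hull:
  fixes a a' :: "'a::euclidean_space"
  assumes "\<And>x. x \<in> C \<Longrightarrow> a \<bullet> x + b = a' \<bullet> x + b'" "x \<in> convex hull C"
  shows "a \<bullet> x + b = a' \<bullet> x + b'"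
proof -
  have "convex hull C \<subseteq> {x. (a - a') \<bullet> x = b' - b}"
  proof (rule hull_minimal)
    show "C \<subseteq> {x. (a - a') \<bullet> x = b' - b}"
      using assms(1) by (force simp: inner_diff_left)
  qed (rule convex_hyperplane)
  then show ?thesis using assms(2) by (force simp: inner_diff_left)
qed

lemma affine_nonneg_on_convex_hull:
  fixes a :: "'a::euclidean_space"
  assumes "\<And>x. x \<in> C \<Longrightarrow> 0 \<le> a \<bullet> x + b" "x \<in> convex hull C"
  shows "0 \<le> a \<bullet> x + b"
proof -
  have "convex hull C \<subseteq> {x. a \<bullet> x \<ge> - b}"
  proof (rule hull_minimal)
    show "C \<subseteq> {x. a \<bullet> x \<ge> - b}" using assms(1) by force
  qed (rule convex_halfspace_ge)
  then show ?thesis using assms(2) by force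
qed

text \<open>A bounded function on a set of finite measure: integrability is obtained for
  \<open>lborel\<close> from Borel measurability and passes to the completion.\<close>

lemma set_integrable_bounded_continuous:
  fixes f :: "'a::euclidean_space \<Rightarrow> real"
  assumes "open U" "bounded U" "continuous_on U f" "bounded (f ` U)"
  shows "set_integrable lebesgue U f"
proof -
  obtain B where B: "\<And>x. x \<in> U \<Longrightarrow> norm (f x) \<le> B"
    using assms(4) by (auto simp: bounded_iff)
  have "(\<lambda>x. indicator U x *\<^sub>R f x) \<in> borel_measurable borel"
    using assms by (intro borel_measurable_continuous_on_indicator) auto
  then have "integrable lborel (\<lambda>x. indicator U x *\<^sub>R f x)"
    using assms(1,2) B emeasure_bounded_finite[OF assms(2)]
    by (intro integrableI_bounded_set[where A = U and B = B])
       (auto simp: indicator_def less_top)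
  then show ?thesis
    unfolding set_integrable_def using \<open>_ \<in> borel_measurable borel\<close>
    by (simp add: integrable_completion)
qed

section \<open>Cayley transform and cross product identities\<close>

text \<open>Since \<open>y \<times> g\<close> is orthogonal to \<open>y\<close>, the equation
  \<open>y = y \<times> g\<close> forces \<open>y \<bullet> y = 0\<close>. The linear map taking
  \<open>y\<close> to \<open>y - y \<times> g\<close> is therefore injective, hence bijective in
  finite dimension.\<close>

lemma cayley_ex1: "\<exists>!y::real^3. y - x = (y + x) \<times> g"
proof -
  have lin: "linear (\<lambda>y::real^3. y - y \<times> g)"
    by (intro linearI) (simp_all add: cross_add_left cross_mult_left scaleR_diff_right)
  have "y = 0" if "y - y \<times> g = 0" for y
    using dot_cross_self(1)[of y g] that by simp
  then have inj: "inj (\<lambda>y::real^3. y - y \<times> g)"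
    using linear_injective_0[OF lin] by blast
  have eq: "y - x = (y + x) \<times> g \<longleftrightarrow> y - y \<times> g = x + x \<times> g" for y
    by (auto simp: cross_add_left diff_eq_eq add.commute add.left_commute)
  obtain y where y: "x + x \<times> g = y - y \<times> g"
    using surjD[OF linear_injective_imp_surjective[OF lin inj]] by blast
  show ?thesis unfolding eq
  proof (rule ex1I)
    show "y - y \<times> g = x + x \<times> g" by (rule y[symmetric])
    show "y' = y" if "y' - y' \<times> g = x + x \<times> g" for y'
      using injD[OF inj, of y' y] that y by simp
  qed
qed

text \<open>Testing the equation with \<open>y + x\<close> kills the cross product and leaves the
  difference of the squared norms.\<close>

lemma norm_cayley:
  fixes x y :: "real^3"
  assumes "y - x = (y + x) \<times> g"
  shows "norm y = norm x"
proof -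
  have "(y + x) \<bullet> (y - x) = 0" by (simp add: assms dot_cross_self)
  then have "y \<bullet> y = x \<bullet> x"
    by (simp add: inner_add_left inner_diff_right inner_commute[of x y])
  then show ?thesis by (simp add: norm_eq)
qed

lemma inner_cross_cross: "((m::real^3) \<times> (m \<times> H)) \<bullet> H = - (norm (m \<times> H))\<^sup>2"
proof -
  have "(m \<times> (m \<times> H)) \<bullet> H = - ((m \<times> H) \<bullet> (m \<times> H))"
    by (simp add: cross3_def inner_vec_def sum_3 algebra_simps)
  then show ?thesis by (simp add: power2_norm_eq_inner)
qed

text \<open>Testing with the field \<open>H\<close> itself leaves only the damping term.\<close>

lemma damping_identity:
  fixes m v H :: "real^3"
  assumes "a *\<^sub>R v + c *\<^sub>R (m \<times> H) + d *\<^sub>R (m \<times> (m \<times> H)) = 0"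
  shows "a * (v \<bullet> H) = d * (norm (m \<times> H))\<^sup>2"
proof -
  have "(a *\<^sub>R v + c *\<^sub>R (m \<times> H) + d *\<^sub>R (m \<times> (m \<times> H))) \<bullet> H = 0"
    by (simp add: assms)
  then show ?thesis
    by (simp add: inner_add_left inner_cross_cross dot_cross_self)
qed

subsection \<open>Piecewise affine functions on a tetrahedral mesh\<close>

locale tetrahedral_mesh =
  fixes \<Omega> :: "(real^3) set" and \<T> :: "(real^3) set set"
  assumes open_dom: "open \<Omega>" and bounded_dom: "bounded \<Omega>"
    and mesh: "tetrahedral_triangulation \<Omega> \<T>"
begin

lemma finite_mesh: "finite \<T>"
  using mesh by (simp add: tetrahedral_triangulation_def triangulation_def)

lemma Union_mesh: "\<Union>\<T> = closure \<Omega>"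
  using mesh by (simp add: tetrahedral_triangulation_def)

lemma mesh_face: "K \<in> \<T> \<Longrightarrow> K' \<in> \<T> \<Longrightarrow> (K \<inter> K') face_of K"
  using mesh by (simp add: tetrahedral_triangulation_def triangulation_def)

lemma element_simplex:
  assumes "K \<in> \<T>"
  obtains C where "\<not> affine_dependent C" "K = convex hull C"
  using assms mesh by (auto simp: tetrahedral_triangulation_def simplex_def)

lemma vertices_independent:
  assumes "K \<in> \<T>"
  shows "\<not> affine_dependent {z. z extreme_point_of K}"
proof -
  obtain C where C: "\<not> affine_dependent C" "K = convex hull C"
    using element_simplex[OF assms] .
  then have "{z. z extreme_point_of K} = C"
    by (simp add: extreme_point_of_convex_hull_affine_independent)
  then show ?thesis using C(1) by simp
qed

lemma compact_element: "K \<in> \<T> \<Longrightarrow> compact K"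
  by (erule element_simplex) (simp add: aff_independent_finite finite_imp_compact_convex_hull)

lemma convex_element: "K \<in> \<T> \<Longrightarrow> convex K"
  by (erule element_simplex) (simp add: convex_convex_hull)

lemma element_hull: "K \<in> \<T> \<Longrightarrow> K = convex hull {z. z extreme_point_of K}"
  by (intro Krein_Milman_Minkowski compact_element convex_element)

lemma extreme_point_in_nodes: "K \<in> \<T> \<Longrightarrow> z extreme_point_of K \<Longrightarrow> z \<in> nodes \<T>"
  by (auto simp: nodes_def)

lemma finite_nodes: "finite (nodes \<T>)"
proof -
  have "nodes \<T> = (\<Union>K\<in>\<T>. {z. z extreme_point_of K})" by (auto simp: nodes_def)
  moreover have "finite {z. z extreme_point_of K}" if "K \<in> \<T>" for K
    by (rule aff_independent_finite[OF vertices_independent[OF that]])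
  ultimately show ?thesis using finite_mesh by simp
qed

lemma element_subset: "K \<in> \<T> \<Longrightarrow> K \<subseteq> closure \<Omega>"
  using Union_mesh by blast

lemma nodes_subset: "nodes \<T> \<subseteq> closure \<Omega>"
  using element_subset by (auto simp: nodes_def extreme_point_of_def)

lemma S1_affine: "f \<in> S1 \<Omega> \<T> \<Longrightarrow> K \<in> \<T> \<Longrightarrow> \<exists>a b. \<forall>x\<in>K. f x = a \<bullet> x + b"
  by (simp add: S1_def)

text \<open>Each tetrahedron is the hull of its vertices, so equality of two affine functions
  spreads from the vertices to the tetrahedron. Off the closure both functions are zero by the
  extension convention.\<close>

lemma S1_eqI:
  assumes f: "f \<in> S1 \<Omega> \<T>" and g: "g \<in> S1 \<Omega> \<T>"
    and eq: "\<And>z. z \<in> nodes \<T> \<Longrightarrow> f z = g z"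
  shows "f = g"
proof
  fix x show "f x = g x"
  proof (cases "x \<in> closure \<Omega>")
    case True
    then obtain K where K: "K \<in> \<T>" "x \<in> K" using Union_mesh by blast
    obtain a b a' b' where ab: "\<And>x. x \<in> K \<Longrightarrow> f x = a \<bullet> x + b" "\<And>x. x \<in> K \<Longrightarrow> g x = a' \<bullet> x + b'"
      using S1_affine[OF f K(1)] S1_affine[OF g K(1)] by metis
    have "a \<bullet> z + b = a' \<bullet> z + b'" if "z \<in> {z. z extreme_point_of K}" for z
    proof -
      have "z \<in> K" using that by (simp add: extreme_point_of_def)
      moreover have "z \<in> nodes \<T>" using that K(1) extreme_point_in_nodes by blast
      ultimately show ?thesis using eq ab by metis
    qed
    then have "a \<bullet> x + b = a' \<bullet> x + b'"
      using affine_eq_on_convex_hull K(2) element_hull[OF K(1)] by blast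
    then show ?thesis using ab K(2) by simp
  qed (use f g in \<open>simp add: S1_def\<close>)
qed

text \<open>Interpolate on each tetrahedron separately and glue. The pieces fit because the mesh is
  conforming.\<close>

lemma S1_exists: "\<exists>f\<in>S1 \<Omega> \<T>. \<forall>z\<in>nodes \<T>. f z = c z"
proof -
  have "\<forall>K\<in>\<T>. \<exists>a b. \<forall>z. z extreme_point_of K \<longrightarrow> a \<bullet> z + b = c z"
  proof
    fix K assume "K \<in> \<T>"
    from affine_interpolation[OF vertices_independent[OF this]]
    show "\<exists>a b. \<forall>z. z extreme_point_of K \<longrightarrow> a \<bullet> z + b = c z" by simp
  qed
  then obtain a b where ab: "\<And>K z. K \<in> \<T> \<Longrightarrow> z extreme_point_of K \<Longrightarrow> a K \<bullet> z + b K = c z"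
    by metis
  \<comment> \<open>Two elements meet in a common face. Its extreme points are vertices of both
    elements, so both affine pieces take the values \<open>c\<close> there and agree on the hull of
    these points, which is the whole face.\<close>
  have consistent: "a K \<bullet> x + b K = a K' \<bullet> x + b K'"
    if K: "K \<in> \<T>" "K' \<in> \<T>" and x: "x \<in> K" "x \<in> K'" for K K' x
  proof -
    let ?F = "K \<inter> K'"
    have face: "?F face_of K" "?F face_of K'"
      using mesh_face[OF K] mesh_face[OF K(2,1)] by (simp_all add: Int_commute)
    have "?F = convex hull {z. z extreme_point_of ?F}"
      using K by (intro Krein_Milman_Minkowski compact_Int convex_Int compact_element convex_element)
    then have "x \<in> convex hull {z. z extreme_point_of ?F}" using x by blast
    then show ?thesis
    proof (rule affine_eq_on_convex_hull[rotated])
      fix z assume "z \<in> {z. z extreme_point_of ?F}"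
      then have "z extreme_point_of K" "z extreme_point_of K'"
        using extreme_point_of_face face by auto
      then show "a K \<bullet> z + b K = a K' \<bullet> z + b K'" using ab K by metis
    qed
  qed
  \<comment> \<open>The chosen element containing \<open>x\<close> is arbitrary; by
    \<open>consistent\<close> the value does not depend on the choice.\<close>
  define f where "f x = (if x \<in> closure \<Omega> then
    (let K = (SOME K. K \<in> \<T> \<and> x \<in> K) in a K \<bullet> x + b K) else 0)" for x
  have f: "f x = a K \<bullet> x + b K" if "K \<in> \<T>" "x \<in> K" for K x
  proof -
    have "\<exists>K. K \<in> \<T> \<and> x \<in> K" using that by blast
    then have *: "(SOME K. K \<in> \<T> \<and> x \<in> K) \<in> \<T> \<and> x \<in> (SOME K. K \<in> \<T> \<and> x \<in> K)"
      by (rule someI_ex)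
    then show ?thesis
      using consistent[of "SOME K. K \<in> \<T> \<and> x \<in> K" K x] that element_subset
      by (auto simp: f_def Let_def)
  qed
  have "continuous_on (\<Union>K\<in>\<T>. K) f"
  proof (rule continuous_on_closed_Union)
    fix K assume "K \<in> \<T>"
    then show "closed K" by (simp add: compact_element compact_imp_closed)
    have "continuous_on K (\<lambda>x. a K \<bullet> x + b K)" by (intro continuous_intros)
    then show "continuous_on K f"
      using f \<open>K \<in> \<T>\<close> by (simp cong: continuous_on_cong)
  qed (rule finite_mesh)
  then have "f \<in> S1 \<Omega> \<T>"
    using f Union_mesh by (auto simp: S1_def f_def[of "_"] intro!: exI)
  moreover have "f z = c z" if "z \<in> nodes \<T>" for z
    using that f ab by (force simp: nodes_def extreme_point_of_def)
  ultimately show ?thesis by blast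
qed

lemma S1_ex1: "\<exists>!f. f \<in> S1 \<Omega> \<T> \<and> (\<forall>z\<in>nodes \<T>. f z = c z)"
  using S1_exists[of c] S1_eqI by metis

lemma S1_nonneg:
  assumes f: "f \<in> S1 \<Omega> \<T>" and nn: "\<And>z. z \<in> nodes \<T> \<Longrightarrow> 0 \<le> f z"
  shows "0 \<le> f x"
proof (cases "x \<in> closure \<Omega>")
  case True
  then obtain K where K: "K \<in> \<T>" "x \<in> K" using Union_mesh by blast
  obtain a b where ab: "\<And>x. x \<in> K \<Longrightarrow> f x = a \<bullet> x + b"
    using S1_affine[OF f K(1)] by metis
  have "0 \<le> a \<bullet> z + b" if "z \<in> {z. z extreme_point_of K}" for z
  proof -
    have "z \<in> K" using that by (simp add: extreme_point_of_def)
    moreover have "z \<in> nodes \<T>" using that K(1) extreme_point_in_nodes by blast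
    ultimately show ?thesis using nn ab by metis
  qed
  then have "0 \<le> a \<bullet> x + b"
    using affine_nonneg_on_convex_hull K(2) element_hull[OF K(1)] by blast
  then show ?thesis using ab K(2) by simp
qed (use f in \<open>simp add: S1_def\<close>)

lemma S1_zero: "(\<lambda>x. 0) \<in> S1 \<Omega> \<T>"
  by (auto simp: S1_def intro!: exI[of _ 0])

lemma S1_add:
  assumes "f \<in> S1 \<Omega> \<T>" "g \<in> S1 \<Omega> \<T>"
  shows "(\<lambda>x. f x + g x) \<in> S1 \<Omega> \<T>"
proof -
  have "\<exists>a b. \<forall>x\<in>K. f x + g x = a \<bullet> x + b" if K: "K \<in> \<T>" for K
  proof -
    obtain a b a' b' where ab: "\<And>x. x \<in> K \<Longrightarrow> f x = a \<bullet> x + b" "\<And>x. x \<in> K \<Longrightarrow> g x = a' \<bullet> x + b'"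
      using S1_affine[OF assms(1) K] S1_affine[OF assms(2) K] by metis
    then have "\<forall>x\<in>K. f x + g x = (a + a') \<bullet> x + (b + b')"
      by (simp add: inner_add_left)
    then show ?thesis by blast
  qed
  then show ?thesis
    using assms by (auto simp: S1_def intro!: continuous_intros)
qed

lemma S1_scale:
  assumes "f \<in> S1 \<Omega> \<T>"
  shows "(\<lambda>x. c * f x) \<in> S1 \<Omega> \<T>"
proof -
  have "\<exists>a b. \<forall>x\<in>K. c * f x = a \<bullet> x + b" if K: "K \<in> \<T>" for K
  proof -
    obtain a b where "\<And>x. x \<in> K \<Longrightarrow> f x = a \<bullet> x + b"
      using S1_affine[OF assms K] by metis
    then have "\<forall>x\<in>K. c * f x = (c *\<^sub>R a) \<bullet> x + c * b"
      by (simp add: distrib_left)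
    then show ?thesis by blast
  qed
  then show ?thesis
    using assms by (auto simp: S1_def intro!: continuous_intros)
qed

lemma S1_vec_add: "u \<in> S1_vec \<Omega> \<T> \<Longrightarrow> w \<in> S1_vec \<Omega> \<T> \<Longrightarrow> (\<lambda>x. u x + w x) \<in> S1_vec \<Omega> \<T>"
  by (simp add: S1_vec_def S1_add)

lemma S1_vec_scale: "u \<in> S1_vec \<Omega> \<T> \<Longrightarrow> (\<lambda>x. c *\<^sub>R u x) \<in> S1_vec \<Omega> \<T>"
  by (simp add: S1_vec_def S1_scale)

lemma S1_vec_zero: "(\<lambda>x. 0) \<in> S1_vec \<Omega> \<T>"
  by (simp add: S1_vec_def S1_zero)

lemma S1_vec_sum:
  "(\<And>i. i \<in> I \<Longrightarrow> u i \<in> S1_vec \<Omega> \<T>) \<Longrightarrow> (\<lambda>x. \<Sum>i\<in>I. u i x) \<in> S1_vec \<Omega> \<T>"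
  by (induction I rule: infinite_finite_induct) (auto simp: S1_vec_zero S1_vec_add)

lemma S1_vec_eqI:
  assumes "u \<in> S1_vec \<Omega> \<T>" "w \<in> S1_vec \<Omega> \<T>" "\<And>z. z \<in> nodes \<T> \<Longrightarrow> u z = w z"
  shows "u = w"
proof -
  have "(\<lambda>x. u x $ i) = (\<lambda>x. w x $ i)" for i
    using assms by (intro S1_eqI) (auto simp: S1_vec_def)
  then show ?thesis by (simp add: fun_eq_iff vec_eq_iff)
qed

subsection \<open>Nodal interpolation and nodal weights\<close>

text \<open>Nodal interpolation. It depends on \<open>c\<close> only through its nodal values, so a
  problem can be solved node by node and the solution then carried back to the finite element
  space.\<close>

definition interp :: "(real^3 \<Rightarrow> real^3) \<Rightarrow> real^3 \<Rightarrow> real^3" where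
  "interp c = (THE u. u \<in> S1_vec \<Omega> \<T> \<and> (\<forall>z\<in>nodes \<T>. u z = c z))"

lemma interp:
  shows interp_in: "interp c \<in> S1_vec \<Omega> \<T>"
    and interp_node: "z \<in> nodes \<T> \<Longrightarrow> interp c z = c z"
proof -
  have "\<forall>i. \<exists>f\<in>S1 \<Omega> \<T>. \<forall>z\<in>nodes \<T>. f z = c z $ i"
    using S1_exists[of "\<lambda>z. c z $ _"] by blast
  then obtain f where f: "\<And>i. f i \<in> S1 \<Omega> \<T>" "\<And>i z. z \<in> nodes \<T> \<Longrightarrow> f i z = c z $ i"
    by metis
  define u where "u x = (\<chi> i. f i x)" for x
  have "u \<in> S1_vec \<Omega> \<T>" "\<forall>z\<in>nodes \<T>. u z = c z"
    using f by (auto simp: S1_vec_def u_def vec_eq_iff)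
  then have "\<exists>!u. u \<in> S1_vec \<Omega> \<T> \<and> (\<forall>z\<in>nodes \<T>. u z = c z)"
    using S1_vec_eqI by metis
  from theI'[OF this]
  show "interp c \<in> S1_vec \<Omega> \<T>" "z \<in> nodes \<T> \<Longrightarrow> interp c z = c z"
    by (auto simp: interp_def)
qed

lemma interp_add: "interp (\<lambda>x. c x + d x) = (\<lambda>x. interp c x + interp d x)"
  by (intro S1_vec_eqI S1_vec_add interp_in) (simp add: interp_node)

lemma interp_scale: "interp (\<lambda>x. r *\<^sub>R c x) = (\<lambda>x. r *\<^sub>R interp c x)"
  by (intro S1_vec_eqI S1_vec_scale interp_in) (simp add: interp_node)

lemma nodal_basis:
  assumes "z \<in> nodes \<T>"
  shows nodal_basis_in: "nodal_basis \<Omega> \<T> z \<in> S1 \<Omega> \<T>"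
    and nodal_basis_node: "z' \<in> nodes \<T> \<Longrightarrow> nodal_basis \<Omega> \<T> z z' = (if z' = z then 1 else 0)"
  using theI'[OF S1_ex1[of "\<lambda>z'. if z' = z then 1 else 0"]]
  by (auto simp: nodal_basis_def)

text \<open>The hat function is nonnegative by \<open>S1_nonneg\<close>. A vanishing integral would
  make its positivity set in \<Omega>, which is open, a null set and so empty, against the value 1
  at \<open>z\<close>.\<close>

lemma nodal_weight_pos:
  assumes z: "z \<in> nodes \<T>"
  shows "0 < nodal_weight \<Omega> \<T> z"
proof -
  let ?f = "nodal_basis \<Omega> \<T> z"
  have cont: "continuous_on (closure \<Omega>) ?f"
    using nodal_basis_in[OF z] by (simp add: S1_def)
  have nn: "0 \<le> ?f x" for x
    by (rule S1_nonneg[OF nodal_basis_in[OF z]]) (simp add: nodal_basis_node[OF z])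
  have cont': "continuous_on \<Omega> ?f"
    by (rule continuous_on_subset[OF cont closure_subset])
  have "bounded (?f ` closure \<Omega>)"
    using bounded_dom cont by (intro compact_imp_bounded compact_continuous_image) auto
  then have "bounded (?f ` \<Omega>)"
    by (rule bounded_subset) (auto intro!: image_mono closure_subset)
  then have "set_integrable lebesgue \<Omega> ?f"
    using open_dom bounded_dom cont' by (intro set_integrable_bounded_continuous)
  then have int: "integrable lebesgue (\<lambda>x. indicator \<Omega> x *\<^sub>R ?f x)"
    by (simp add: set_integrable_def)
  have "integral\<^sup>L lebesgue (\<lambda>x. indicator \<Omega> x *\<^sub>R ?f x) \<noteq> 0"
  proof
    assume "integral\<^sup>L lebesgue (\<lambda>x. indicator \<Omega> x *\<^sub>R ?f x) = 0"
    then have AE: "AE x in lebesgue. indicator \<Omega> x *\<^sub>R ?f x = 0"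
      using integral_nonneg_eq_0_iff_AE[OF int] nn by (auto simp: indicator_def)
    define V where "V = {x \<in> \<Omega>. 0 < ?f x}"
    have "V = \<Omega> \<inter> ?f -` {0<..}" by (auto simp: V_def)
    then have "open V"
      using continuous_open_preimage[OF cont' open_dom, of "{0<..}"] by simp
    have "negligible V"
    proof -
      have "V \<in> sets lebesgue" using \<open>open V\<close> by (simp add: borel_open)
      moreover have "AE x in lebesgue. x \<notin> V"
        using AE by eventually_elim (auto simp: V_def)
      ultimately show ?thesis
        by (simp add: negligible_iff_null_sets AE_iff_null_sets)
    qed
    then have "V = {}" using \<open>open V\<close> open_not_negligible by blast
    \<comment> \<open>The node \<open>z\<close> may lie on the boundary of \<Omega>, so the bound
      has to be carried to the closure by continuity before it can be evaluated at
      \<open>z\<close>.\<close>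
    then have "?f ` \<Omega> \<subseteq> {..0}" by (force simp: V_def)
    then have "?f ` closure \<Omega> \<subseteq> {..0}"
      using image_closure_subset[OF cont] by blast
    then have "?f z \<le> 0" using nodes_subset z by blast
    then show False by (simp add: nodal_basis_node[OF z z])
  qed
  moreover have "0 \<le> integral\<^sup>L lebesgue (\<lambda>x. indicator \<Omega> x *\<^sub>R ?f x)"
    using nn by (intro integral_nonneg_AE) (auto simp: indicator_def)
  ultimately show ?thesis
    by (simp add: nodal_weight_def set_lebesgue_integral_def)
qed

subsection \<open>The Dirichlet form\<close>

lemma S1_vec_grad:
  assumes u: "u \<in> S1_vec \<Omega> \<T>" and K: "K \<in> \<T>"
  shows "\<exists>A. \<forall>x\<in>interior K. (u has_derivative (*v) A) (at x)"
proof -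
  have "\<forall>i. \<exists>a b. \<forall>x\<in>K. u x $ i = a \<bullet> x + b"
    using S1_affine[OF _ K] u by (auto simp: S1_vec_def)
  then obtain a b where ab: "\<And>i x. x \<in> K \<Longrightarrow> u x $ i = a i \<bullet> x + b i" by metis
  define A where "A = (\<chi> i. a i)"
  have eq: "u x = A *v x + (\<chi> i. b i)" if "x \<in> K" for x
    using ab[OF that] by (simp add: vec_eq_iff A_def matrix_vector_mul_component)
  have "(u has_derivative (*v) A) (at x)" if "x \<in> interior K" for x
  proof (rule has_derivative_transform_within_open)
    show "((\<lambda>x. A *v x + (\<chi> i. b i)) has_derivative (*v) A) (at x)"
      by (auto intro!: derivative_eq_intros bounded_linear_imp_has_derivative)
    show "A *v y + (\<chi> i. b i) = u y" if "y \<in> interior K" for y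
      using eq that interior_subset by (metis subsetD)
  qed (use that in auto)
  then show ?thesis by blast
qed

lemma grad_eq: "(u has_derivative (*v) A) (at x) \<Longrightarrow> grad u x = A"
  by (simp add: grad_def jacobian_def matrix_of_matrix_vector_mul flip: frechet_derivative_at)

text \<open>The points where every finite element function is classically differentiable, so that
  \<open>grad\<close> is linear there. Gradient identities are proved on this set and hold up to a
  null set on \<Omega>.\<close>

definition regular :: "(real^3) set" where
  "regular = \<Omega> \<inter> (\<Union>K\<in>\<T>. interior K)"

text \<open>A remaining point lies in some element but in no interior, hence on the boundary of a
  convex set. Such boundaries are null, and there are finitely many.\<close>

lemma negligible_irregular: "negligible (\<Omega> - regular)"
proof (rule negligible_subset)
  show "negligible (\<Union>K\<in>\<T>. frontier K)"
    using finite_mesh by (intro negligible_Union) (auto intro: negligible_convex_frontier convex_element)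
  show "\<Omega> - regular \<subseteq> (\<Union>K\<in>\<T>. frontier K)"
  proof
    fix x assume x: "x \<in> \<Omega> - regular"
    then obtain K where K: "K \<in> \<T>" "x \<in> K"
      using Union_mesh closure_subset by blast
    then have "x \<in> frontier K"
      using x closure_subset by (auto simp: frontier_def regular_def)
    then show "x \<in> (\<Union>K\<in>\<T>. frontier K)" using K by blast
  qed
qed

lemma grad_has_derivative:
  assumes "u \<in> S1_vec \<Omega> \<T>" "x \<in> regular"
  shows "(u has_derivative (*v) (grad u x)) (at x)"
proof -
  obtain K where "K \<in> \<T>" "x \<in> interior K" using assms(2) by (auto simp: regular_def)
  then obtain A where "(u has_derivative (*v) A) (at x)"
    using S1_vec_grad[OF assms(1)] by metis
  then show ?thesis using grad_eq by metis
qed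

lemma grad_add:
  assumes "u \<in> S1_vec \<Omega> \<T>" "w \<in> S1_vec \<Omega> \<T>" "x \<in> regular"
  shows "grad (\<lambda>x. u x + w x) x = grad u x + grad w x"
proof (rule grad_eq)
  have "((\<lambda>x. u x + w x) has_derivative (\<lambda>h. grad u x *v h + grad w x *v h)) (at x)"
    using assms by (intro has_derivative_add grad_has_derivative)
  then show "((\<lambda>x. u x + w x) has_derivative (*v) (grad u x + grad w x)) (at x)"
    by (simp add: matrix_vector_mult_add_rdistrib[abs_def])
qed

lemma grad_scale:
  assumes "u \<in> S1_vec \<Omega> \<T>" "x \<in> regular"
  shows "grad (\<lambda>x. c *\<^sub>R u x) x = c *\<^sub>R grad u x"
proof (rule grad_eq)
  have "((\<lambda>x. c *\<^sub>R u x) has_derivative (\<lambda>h. c *\<^sub>R (grad u x *v h))) (at x)"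
    using assms by (intro has_derivative_scaleR_right grad_has_derivative)
  then show "((\<lambda>x. c *\<^sub>R u x) has_derivative (*v) (c *\<^sub>R grad u x)) (at x)"
    by (simp add: scaleR_matrix_vector_assoc)
qed

text \<open>The integrand is constant on the interior of each element: on \<open>regular\<close> it
  is continuous and takes finitely many values. The null set left over in \<Omega> does not affect
  integrability.\<close>

lemma set_integrable_grad:
  assumes u: "u \<in> S1_vec \<Omega> \<T>" and w: "w \<in> S1_vec \<Omega> \<T>"
  shows "set_integrable lebesgue \<Omega> (\<lambda>x. grad u x \<bullet> grad w x)"
proof -
  let ?q = "\<lambda>x. grad u x \<bullet> grad w x"
  have "\<forall>K\<in>\<T>. \<exists>r. \<forall>x\<in>interior K. ?q x = r"
    using S1_vec_grad[OF u] S1_vec_grad[OF w] grad_eq by metis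
  then obtain r where r: "\<And>K x. K \<in> \<T> \<Longrightarrow> x \<in> interior K \<Longrightarrow> ?q x = r K" by metis
  have op: "open regular" unfolding regular_def using open_dom by (intro open_Int open_UN) auto
  have "set_integrable lebesgue regular ?q"
  proof (rule set_integrable_bounded_continuous)
    show "bounded regular" using bounded_dom by (auto simp: regular_def intro: bounded_Int)
    have "?q ` regular \<subseteq> r ` \<T>" using r by (auto simp: regular_def)
    then show "bounded (?q ` regular)"
      using finite_mesh by (intro finite_imp_bounded) (rule finite_surj)
    have "isCont ?q x" if x: "x \<in> regular" for x
    proof -
      obtain K where K: "K \<in> \<T>" "x \<in> interior K" using x by (auto simp: regular_def)
      have "continuous_on (interior K) ?q"
        using r[OF K(1)] by (simp cong: continuous_on_cong)
      then show ?thesis using K(2) by (simp add: continuous_on_eq_continuous_at)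
    qed
    then show "continuous_on regular ?q" by (simp add: continuous_at_imp_continuous_on)
  qed (rule op)
  then show ?thesis
  proof (rule absolutely_integrable_spike_set)
    have "{x \<in> regular - \<Omega>. ?q x \<noteq> 0} = {}" by (auto simp: regular_def)
    then show "negligible {x \<in> regular - \<Omega>. ?q x \<noteq> 0}" by (simp only: negligible_empty)
    show "negligible {x \<in> \<Omega> - regular. ?q x \<noteq> 0}"
      by (rule negligible_subset[OF negligible_irregular]) blast
  qed
qed

abbreviation dirichlet :: "(real^3 \<Rightarrow> real^3) \<Rightarrow> (real^3 \<Rightarrow> real^3) \<Rightarrow> real" where
  "dirichlet u w \<equiv> L2_prod \<Omega> (grad u) (grad w)"

text \<open>Passing to the gauge integral lets \<open>integral_spike\<close> change the integrand on
  the null set outside \<open>regular\<close>.\<close>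

lemma dirichlet_integral:
  assumes "u \<in> S1_vec \<Omega> \<T>" "w \<in> S1_vec \<Omega> \<T>"
  shows "dirichlet u w = integral \<Omega> (\<lambda>x. grad u x \<bullet> grad w x)"
  unfolding L2_prod_def by (rule set_lebesgue_integral_eq_integral(2)[OF set_integrable_grad[OF assms]])

lemma integrable_on_grad:
  assumes "u \<in> S1_vec \<Omega> \<T>" "w \<in> S1_vec \<Omega> \<T>"
  shows "(\<lambda>x. grad u x \<bullet> grad w x) integrable_on \<Omega>"
  using set_lebesgue_integral_eq_integral(1)[OF set_integrable_grad[OF assms]] by simp

lemma dirichlet_commute: "dirichlet u w = dirichlet w u"
  by (simp add: L2_prod_def inner_commute)

lemma dirichlet_nonneg: "0 \<le> dirichlet u u"
  unfolding L2_prod_def set_lebesgue_integral_def by (intro integral_nonneg_AE) simp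

lemma dirichlet_add_right:
  assumes u: "u \<in> S1_vec \<Omega> \<T>" and w: "w \<in> S1_vec \<Omega> \<T>" "w' \<in> S1_vec \<Omega> \<T>"
  shows "dirichlet u (\<lambda>x. w x + w' x) = dirichlet u w + dirichlet u w'"
proof -
  have "dirichlet u (\<lambda>x. w x + w' x) = integral \<Omega> (\<lambda>x. grad u x \<bullet> grad (\<lambda>x. w x + w' x) x)"
    by (intro dirichlet_integral u S1_vec_add w)
  also have "\<dots> = integral \<Omega> (\<lambda>x. grad u x \<bullet> grad w x + grad u x \<bullet> grad w' x)"
    by (rule integral_spike[OF negligible_irregular])
       (use grad_add[OF w] in \<open>auto simp: inner_add_right\<close>)
  also have "\<dots> = dirichlet u w + dirichlet u w'"
    using assms by (simp add: integral_add integrable_on_grad dirichlet_integral)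
  finally show ?thesis .
qed

lemma dirichlet_scale_right:
  assumes u: "u \<in> S1_vec \<Omega> \<T>" and w: "w \<in> S1_vec \<Omega> \<T>"
  shows "dirichlet u (\<lambda>x. c *\<^sub>R w x) = c * dirichlet u w"
proof -
  have "dirichlet u (\<lambda>x. c *\<^sub>R w x) = integral \<Omega> (\<lambda>x. grad u x \<bullet> grad (\<lambda>x. c *\<^sub>R w x) x)"
    by (intro dirichlet_integral u S1_vec_scale w)
  also have "\<dots> = integral \<Omega> (\<lambda>x. c * (grad u x \<bullet> grad w x))"
    by (rule integral_spike[OF negligible_irregular]) (use grad_scale[OF w] in auto)
  also have "\<dots> = c * dirichlet u w"
    using assms by (simp add: dirichlet_integral)
  finally show ?thesis .
qed

lemma dirichlet_sum_right:
  assumes "u \<in> S1_vec \<Omega> \<T>" "\<And>i. i \<in> I \<Longrightarrow> w i \<in> S1_vec \<Omega> \<T>" "finite I"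
  shows "dirichlet u (\<lambda>x. \<Sum>i\<in>I. w i x) = (\<Sum>i\<in>I. dirichlet u (w i))"
  using assms(3,2)
proof (induction I rule: finite_induct)
  case empty
  \<comment> \<open>The empty sum is the zero function, treated as a multiple by 0.\<close>
  then show ?case using dirichlet_scale_right[OF assms(1) S1_vec_zero, of 0] by simp
next
  case (insert i I)
  then show ?case using assms(1) by (simp add: dirichlet_add_right S1_vec_sum)
qed

subsection \<open>The discrete Laplacian\<close>

lemma lumped_commute: "lumped \<Omega> \<T> u w = lumped \<Omega> \<T> w u"
  by (simp add: lumped_def inner_commute)

lemma lumped_add_left: "lumped \<Omega> \<T> (\<lambda>x. u x + u' x) w = lumped \<Omega> \<T> u w + lumped \<Omega> \<T> u' w"
  by (simp add: lumped_def inner_add_left distrib_left sum.distrib)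

lemma lumped_diff_left: "lumped \<Omega> \<T> (\<lambda>x. u x - u' x) w = lumped \<Omega> \<T> u w - lumped \<Omega> \<T> u' w"
  by (simp add: lumped_def inner_diff_left right_diff_distrib sum_subtractf)

lemma lumped_scale_left: "lumped \<Omega> \<T> (\<lambda>x. c *\<^sub>R u x) w = c * lumped \<Omega> \<T> u w"
  by (simp add: lumped_def sum_distrib_left mult.left_commute)

text \<open>This is the decoupling of the variational problems. The test function equal to
  \<open>u z - u' z\<close> at the node \<open>z\<close> and zero at the other nodes isolates the
  weight at \<open>z\<close> times the squared distance; positivity of the weight does the
  rest.\<close>

lemma lumped_eq_iff:
  "(\<forall>w\<in>S1_vec \<Omega> \<T>. lumped \<Omega> \<T> u w = lumped \<Omega> \<T> u' w) \<longleftrightarrow> (\<forall>z\<in>nodes \<T>. u z = u' z)"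
proof (intro iffI ballI)
  fix z assume eq: "\<forall>w\<in>S1_vec \<Omega> \<T>. lumped \<Omega> \<T> u w = lumped \<Omega> \<T> u' w" and z: "z \<in> nodes \<T>"
  define w where "w = interp (\<lambda>x. if x = z then u z - u' z else 0)"
  have "0 = lumped \<Omega> \<T> (\<lambda>x. u x - u' x) w"
    using eq interp_in by (simp add: w_def lumped_diff_left)
  also have "\<dots> = (\<Sum>x\<in>nodes \<T>. if x = z then nodal_weight \<Omega> \<T> z * ((u z - u' z) \<bullet> (u z - u' z)) else 0)"
    unfolding lumped_def w_def by (intro sum.cong refl) (simp add: interp_node)
  also have "\<dots> = nodal_weight \<Omega> \<T> z * ((u z - u' z) \<bullet> (u z - u' z))"
    using finite_nodes z by simp
  finally show "u z = u' z" using nodal_weight_pos[OF z] by simp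
qed (simp add: lumped_def)

text \<open>The vector-valued basis function: the scalar hat function at \<open>z\<close> times the
  constant vector \<open>b\<close>.\<close>

definition hat :: "real^3 \<Rightarrow> real^3 \<Rightarrow> real^3 \<Rightarrow> real^3" where
  "hat z b = interp (\<lambda>x. if x = z then b else 0)"

lemma hat_expansion:
  assumes "y \<in> S1_vec \<Omega> \<T>"
  shows "y = (\<lambda>x. \<Sum>z\<in>nodes \<T>. \<Sum>b\<in>Basis. (y z \<bullet> b) *\<^sub>R hat z b x)"
proof (rule S1_vec_eqI[OF assms])
  show "(\<lambda>x. \<Sum>z\<in>nodes \<T>. \<Sum>b\<in>Basis. (y z \<bullet> b) *\<^sub>R hat z b x) \<in> S1_vec \<Omega> \<T>"
    unfolding hat_def by (intro S1_vec_sum S1_vec_scale interp_in)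
  fix x assume x: "x \<in> nodes \<T>"
  have "(\<Sum>z\<in>nodes \<T>. \<Sum>b\<in>Basis. (y z \<bullet> b) *\<^sub>R hat z b x) = (\<Sum>z\<in>nodes \<T>. if x = z then y z else 0)"
    by (intro sum.cong refl) (auto simp: hat_def interp_node x euclidean_representation)
  also have "\<dots> = y x" using finite_nodes x by simp
  finally show "y x = (\<Sum>z\<in>nodes \<T>. \<Sum>b\<in>Basis. (y z \<bullet> b) *\<^sub>R hat z b x)" by simp
qed

text \<open>The lumped product is diagonal in the nodal basis, so the functional
  \<open>dirichlet w\<close> can be represented by an explicit formula.\<close>

lemma laplacian_exists:
  assumes w: "w \<in> S1_vec \<Omega> \<T>"
  shows "\<exists>d\<in>S1_vec \<Omega> \<T>. \<forall>y\<in>S1_vec \<Omega> \<T>. - lumped \<Omega> \<T> d y = dirichlet w y"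
proof -
  \<comment> \<open>Testing the defining equation with \<open>hat z b\<close> forces these nodal
    values.\<close>
  define D where "D z = (\<Sum>b\<in>Basis. (- dirichlet w (hat z b) / nodal_weight \<Omega> \<T> z) *\<^sub>R b)" for z
  have D: "dirichlet w (hat z b) = - (nodal_weight \<Omega> \<T> z * (D z \<bullet> b))"
    if "b \<in> Basis" "z \<in> nodes \<T>" for z b
    using that nodal_weight_pos[OF that(2)]
    by (simp only: D_def inner_sum_left_Basis) simp
  have "- lumped \<Omega> \<T> (interp D) y = dirichlet w y" if y: "y \<in> S1_vec \<Omega> \<T>" for y
  proof -
    have hat_in: "hat z b \<in> S1_vec \<Omega> \<T>" for z b by (simp add: hat_def interp_in)
    have "dirichlet w y = dirichlet w (\<lambda>x. \<Sum>z\<in>nodes \<T>. \<Sum>b\<in>Basis. (y z \<bullet> b) *\<^sub>R hat z b x)"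
      by (rule arg_cong[OF hat_expansion[OF y], where f = "\<lambda>y. dirichlet w y"])
    also have "\<dots> = (\<Sum>z\<in>nodes \<T>. \<Sum>b\<in>Basis. (y z \<bullet> b) * dirichlet w (hat z b))"
      using w hat_in finite_nodes
      by (simp add: dirichlet_sum_right S1_vec_sum S1_vec_scale dirichlet_scale_right)
    also have "\<dots> = (\<Sum>z\<in>nodes \<T>. \<Sum>b\<in>Basis. - (nodal_weight \<Omega> \<T> z * ((D z \<bullet> b) * (y z \<bullet> b))))"
      by (intro sum.cong refl) (simp add: D mult_ac)
    also have "\<dots> = - lumped \<Omega> \<T> (interp D) y"
    proof -
      have "D z \<bullet> y z = (\<Sum>b\<in>Basis. (D z \<bullet> b) * (y z \<bullet> b))" for z
        by (rule euclidean_inner)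
      then show ?thesis
        by (simp add: lumped_def interp_node sum_negf sum_distrib_left)
    qed
    finally show ?thesis by simp
  qed
  then show ?thesis using interp_in by blast
qed

lemma laplacian_ex1:
  assumes "w \<in> S1_vec \<Omega> \<T>"
  shows "\<exists>!d. d \<in> S1_vec \<Omega> \<T> \<and> (\<forall>y\<in>S1_vec \<Omega> \<T>. - lumped \<Omega> \<T> d y = dirichlet w y)"
proof -
  have "d = d'" if "d \<in> S1_vec \<Omega> \<T>" "d' \<in> S1_vec \<Omega> \<T>"
    "\<forall>y\<in>S1_vec \<Omega> \<T>. - lumped \<Omega> \<T> d y = dirichlet w y"
    "\<forall>y\<in>S1_vec \<Omega> \<T>. - lumped \<Omega> \<T> d' y = dirichlet w y" for d d'
  proof -
    have "\<forall>y\<in>S1_vec \<Omega> \<T>. lumped \<Omega> \<T> d y = lumped \<Omega> \<T> d' y"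
      using that(3,4) by (metis neg_equal_iff_equal)
    then show ?thesis
      using S1_vec_eqI[OF that(1,2)] unfolding lumped_eq_iff by blast
  qed
  then show ?thesis using laplacian_exists[OF assms] by blast
qed

abbreviation laplacian :: "(real^3 \<Rightarrow> real^3) \<Rightarrow> real^3 \<Rightarrow> real^3" where
  "laplacian \<equiv> discrete_laplacian \<Omega> \<T>"

lemma laplacian:
  assumes "w \<in> S1_vec \<Omega> \<T>"
  shows laplacian_in: "laplacian w \<in> S1_vec \<Omega> \<T>"
    and lumped_laplacian: "y \<in> S1_vec \<Omega> \<T> \<Longrightarrow> lumped \<Omega> \<T> (laplacian w) y = - dirichlet w y"
  using theI'[OF laplacian_ex1[OF assms]] by (auto simp: discrete_laplacian_def)

lemma laplacian_eqI:
  assumes "w \<in> S1_vec \<Omega> \<T>" "d \<in> S1_vec \<Omega> \<T>"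
    "\<And>y. y \<in> S1_vec \<Omega> \<T> \<Longrightarrow> lumped \<Omega> \<T> d y = - dirichlet w y"
  shows "laplacian w = d"
  unfolding discrete_laplacian_def
  by (rule the1_equality[OF laplacian_ex1[OF assms(1)]]) (simp add: assms)

text \<open>By uniqueness it suffices that the right-hand side satisfies the defining equation;
  symmetry of the Dirichlet form moves the sum into the argument whose linearity is known.\<close>

lemma laplacian_add:
  assumes "u \<in> S1_vec \<Omega> \<T>" "w \<in> S1_vec \<Omega> \<T>"
  shows "laplacian (\<lambda>x. u x + w x) = (\<lambda>x. laplacian u x + laplacian w x)"
proof (intro laplacian_eqI S1_vec_add assms laplacian_in)
  fix y assume y: "y \<in> S1_vec \<Omega> \<T>"
  show "lumped \<Omega> \<T> (\<lambda>x. laplacian u x + laplacian w x) y = - dirichlet (\<lambda>x. u x + w x) y"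
    using dirichlet_add_right[OF y assms] assms y
    by (simp add: lumped_add_left lumped_laplacian dirichlet_commute[of _ y])
qed

lemma laplacian_scale:
  assumes "u \<in> S1_vec \<Omega> \<T>"
  shows "laplacian (\<lambda>x. c *\<^sub>R u x) = (\<lambda>x. c *\<^sub>R laplacian u x)"
proof (intro laplacian_eqI S1_vec_scale assms laplacian_in)
  fix y assume y: "y \<in> S1_vec \<Omega> \<T>"
  show "lumped \<Omega> \<T> (\<lambda>x. c *\<^sub>R laplacian u x) y = - dirichlet (\<lambda>x. c *\<^sub>R u x) y"
    using dirichlet_scale_right[OF y assms] assms y
    by (simp add: lumped_scale_left lumped_laplacian dirichlet_commute[of _ y])
qed

lemma interp_id: "u \<in> S1_vec \<Omega> \<T> \<Longrightarrow> interp u = u"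
  by (intro S1_vec_eqI interp_in) (simp_all add: interp_node)

subsection \<open>Predictor\<close>

text \<open>With \<open>a = 1 + \<alpha>\<^sup>2\<close> and \<open>s = \<theta> k\<close> this is the linear part of the predictor equation;
  with \<open>a = 0\<close>, \<open>s = 1\<close> and \<open>f = m\<close> it is minus the inhomogeneity.\<close>

definition predictor_op ::
  "real \<Rightarrow> real \<Rightarrow> real \<Rightarrow> real \<Rightarrow> (real^3 \<Rightarrow> real^3) \<Rightarrow> (real^3 \<Rightarrow> real^3) \<Rightarrow> real^3 \<Rightarrow> real^3" where
  "predictor_op a c d s m f z = (if z \<in> nodes \<T> then
     let H = laplacian (interp f) z in
       a *\<^sub>R f z + (s * c) *\<^sub>R (m z \<times> H) + (s * d) *\<^sub>R (m z \<times> (m z \<times> H)) else 0)"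

lemma predictor_op_add:
  "predictor_op a c d s m (\<lambda>x. f x + g x) = (\<lambda>x. predictor_op a c d s m f x + predictor_op a c d s m g x)"
  by (auto simp: predictor_op_def Let_def interp_add laplacian_add interp_in cross_add_right scaleR_add_right)

lemma predictor_op_scale:
  "predictor_op a c d s m (\<lambda>x. r *\<^sub>R f x) = (\<lambda>x. r *\<^sub>R predictor_op a c d s m f x)"
  by (auto simp: predictor_op_def Let_def interp_scale laplacian_scale interp_in cross_mult_right
      scaleR_add_right mult_ac)

text \<open>Two opposite signs meet: the weighted sum of \<open>v x \<bullet> H x\<close> is at most
  0 since \<open>s \<ge> 0\<close>, while every summand is at least 0 by
  \<open>damping_identity\<close>. So each summand vanishes, then \<open>m z \<times> H z\<close>
  because \<open>d > 0\<close>, then \<open>v z\<close> because \<open>a > 0\<close>.\<close>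

lemma predictor_op_inj:
  assumes "a > 0" "d > 0" "s \<ge> 0"
    and zero: "predictor_op a c d s m f = (\<lambda>_. 0)" and z: "z \<in> nodes \<T>"
  shows "f z = 0"
proof -
  define v where "v = interp f"
  define H where "H = laplacian (\<lambda>x. s *\<^sub>R v x)"
  have v: "v \<in> S1_vec \<Omega> \<T>" by (simp add: v_def interp_in)
  have H: "H x = s *\<^sub>R laplacian v x" for x
    by (simp add: H_def laplacian_scale v)
  \<comment> \<open>The factor \<open>s\<close> in front of \<open>c\<close> and \<open>d\<close> is
    absorbed into \<open>H\<close>, which gives the form required by
    \<open>damping_identity\<close>.\<close>
  have eq: "a *\<^sub>R v z + c *\<^sub>R (m z \<times> H z) + d *\<^sub>R (m z \<times> (m z \<times> H z)) = 0" if "z \<in> nodes \<T>" for z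
    using fun_cong[OF zero, of z] that
    by (simp add: predictor_op_def Let_def H cross_mult_right interp_node mult_ac flip: v_def)
       (simp add: v_def interp_node)
  have "lumped \<Omega> \<T> v H = lumped \<Omega> \<T> H v" by (rule lumped_commute)
  also have "\<dots> = - (s * dirichlet v v)"
    using dirichlet_scale_right[OF v v, of s]
    by (simp add: H_def lumped_laplacian S1_vec_scale v dirichlet_commute[of "\<lambda>x. s *\<^sub>R v x"])
  also have "\<dots> \<le> 0"
    using assms dirichlet_nonneg by simp
  finally have le: "lumped \<Omega> \<T> v H \<le> 0" .
  have nn: "0 \<le> nodal_weight \<Omega> \<T> x * (v x \<bullet> H x)" if "x \<in> nodes \<T>" for x
  proof -
    have "0 \<le> a * (v x \<bullet> H x)"
      using damping_identity[OF eq[OF that]] assms by simp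
    then show ?thesis
      using nodal_weight_pos[OF that] \<open>a > 0\<close> by (simp add: zero_le_mult_iff)
  qed
  have "(\<Sum>x\<in>nodes \<T>. nodal_weight \<Omega> \<T> x * (v x \<bullet> H x)) = 0"
    using le by (intro antisym sum_nonneg nn) (simp_all add: lumped_def)
  then have "nodal_weight \<Omega> \<T> z * (v z \<bullet> H z) = 0"
    using z by (simp only: sum_nonneg_eq_0_iff[OF finite_nodes nn])
  then have "v z \<bullet> H z = 0"
    using nodal_weight_pos[OF z] by simp
  then have "m z \<times> H z = 0"
    using damping_identity[OF eq[OF z]] assms by simp
  then have "v z = 0" using eq[OF z] assms by simp
  then show ?thesis by (simp add: v_def interp_node z)
qed

text \<open>\<open>lumped_eq_iff\<close> passes to the nodes, and linearity of the discrete
  Laplacian separates the unknown part of the field from the known part coming from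
  \<open>m\<close>.\<close>

lemma predictor_iff:
  assumes m: "m \<in> S1_vec \<Omega> \<T>"
  shows "predictor \<Omega> \<T> \<alpha> l_ex \<theta> k m v \<longleftrightarrow> v \<in> S1_vec \<Omega> \<T> \<and>
    predictor_op (1 + \<alpha>\<^sup>2) (l_ex\<^sup>2) (\<alpha> * l_ex\<^sup>2) (\<theta> * k) m v =
    (\<lambda>z. - predictor_op 0 (l_ex\<^sup>2) (\<alpha> * l_ex\<^sup>2) 1 m m z)"
proof (cases "v \<in> S1_vec \<Omega> \<T>")
  case v: True
  let ?H = "laplacian (\<lambda>x. m x + (\<theta> * k) *\<^sub>R v x)"
  have H: "?H z = laplacian m z + (\<theta> * k) *\<^sub>R laplacian v z" for z
    using m v by (simp add: laplacian_add laplacian_scale S1_vec_scale)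
  have "predictor \<Omega> \<T> \<alpha> l_ex \<theta> k m v \<longleftrightarrow>
    (\<forall>w\<in>S1_vec \<Omega> \<T>. lumped \<Omega> \<T> (\<lambda>z. (1 + \<alpha>\<^sup>2) *\<^sub>R v z) w =
      lumped \<Omega> \<T> (\<lambda>z. (- l_ex\<^sup>2) *\<^sub>R (m z \<times> ?H z) - (\<alpha> * l_ex\<^sup>2) *\<^sub>R (m z \<times> (m z \<times> ?H z))) w)"
    unfolding lumped_diff_left lumped_scale_left by (simp add: predictor_def Let_def v)
  also have "\<dots> \<longleftrightarrow> (\<forall>z\<in>nodes \<T>. (1 + \<alpha>\<^sup>2) *\<^sub>R v z =
      (- l_ex\<^sup>2) *\<^sub>R (m z \<times> ?H z) - (\<alpha> * l_ex\<^sup>2) *\<^sub>R (m z \<times> (m z \<times> ?H z)))"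
    by (rule lumped_eq_iff)
  also have "\<dots> \<longleftrightarrow> (\<forall>z. predictor_op (1 + \<alpha>\<^sup>2) (l_ex\<^sup>2) (\<alpha> * l_ex\<^sup>2) (\<theta> * k) m v z =
    - predictor_op 0 (l_ex\<^sup>2) (\<alpha> * l_ex\<^sup>2) 1 m m z)"
  proof -
    have on: "(1 + \<alpha>\<^sup>2) *\<^sub>R v z = (- l_ex\<^sup>2) *\<^sub>R (m z \<times> ?H z) - (\<alpha> * l_ex\<^sup>2) *\<^sub>R (m z \<times> (m z \<times> ?H z)) \<longleftrightarrow>
      predictor_op (1 + \<alpha>\<^sup>2) (l_ex\<^sup>2) (\<alpha> * l_ex\<^sup>2) (\<theta> * k) m v z =
    - predictor_op 0 (l_ex\<^sup>2) (\<alpha> * l_ex\<^sup>2) 1 m m z" if "z \<in> nodes \<T>" for z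
    proof -
      let ?a = "(1 + \<alpha>\<^sup>2) *\<^sub>R v z"
      let ?P = "l_ex\<^sup>2 *\<^sub>R (m z \<times> laplacian m z)"
      let ?Q = "(\<alpha> * l_ex\<^sup>2) *\<^sub>R (m z \<times> (m z \<times> laplacian m z))"
      let ?P' = "(\<theta> * k * l_ex\<^sup>2) *\<^sub>R (m z \<times> laplacian v z)"
      let ?Q' = "(\<theta> * k * (\<alpha> * l_ex\<^sup>2)) *\<^sub>R (m z \<times> (m z \<times> laplacian v z))"
      have 1: "(- l_ex\<^sup>2) *\<^sub>R (m z \<times> ?H z) - (\<alpha> * l_ex\<^sup>2) *\<^sub>R (m z \<times> (m z \<times> ?H z)) = - ?P - ?Q - ?P' - ?Q'"
        by (simp add: H cross_add_right cross_mult_right scaleR_add_right mult_ac)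
      have 2: "predictor_op (1 + \<alpha>\<^sup>2) (l_ex\<^sup>2) (\<alpha> * l_ex\<^sup>2) (\<theta> * k) m v z = ?a + ?P' + ?Q'"
        "predictor_op 0 (l_ex\<^sup>2) (\<alpha> * l_ex\<^sup>2) 1 m m z = ?P + ?Q"
        using that m v by (simp_all add: predictor_op_def Let_def interp_id)
      have "A = - P - Q - P' - Q' \<longleftrightarrow> A + P' + Q' = - (P + Q)" for A P Q P' Q' :: "real^3"
        by (auto simp: algebra_simps)
      then show ?thesis unfolding 1 2 .
    qed
    \<comment> \<open>Off the nodes both sides are 0 by definition, so the nodal equations become an
      equality of functions.\<close>
    have "predictor_op (1 + \<alpha>\<^sup>2) (l_ex\<^sup>2) (\<alpha> * l_ex\<^sup>2) (\<theta> * k) m v z =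
      - predictor_op 0 (l_ex\<^sup>2) (\<alpha> * l_ex\<^sup>2) 1 m m z" if "z \<notin> nodes \<T>" for z
      using that by (simp add: predictor_op_def)
    with on show ?thesis by blast
  qed
  finally show ?thesis by (simp add: v fun_eq_iff)
qed (simp add: predictor_def)

lemma predictor_ex1:
  assumes m: "m \<in> S1_vec \<Omega> \<T>" and pos: "\<alpha> > 0" "l_ex > 0" "\<theta> * k \<ge> 0"
  shows "\<exists>!v. predictor \<Omega> \<T> \<alpha> l_ex \<theta> k m v"
proof -
  define F where "F = predictor_op (1 + \<alpha>\<^sup>2) (l_ex\<^sup>2) (\<alpha> * l_ex\<^sup>2) (\<theta> * k) m"
  define r where "r z = - predictor_op 0 (l_ex\<^sup>2) (\<alpha> * l_ex\<^sup>2) 1 m m z" for z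
  have inj: "f z = 0" if "F f = (\<lambda>_. 0)" "z \<in> nodes \<T>" for f z
    by (rule predictor_op_inj[OF _ _ pos(3) that[unfolded F_def]])
       (use pos in \<open>simp_all add: add_pos_nonneg\<close>)
  have iff: "predictor \<Omega> \<T> \<alpha> l_ex \<theta> k m v \<longleftrightarrow> v \<in> S1_vec \<Omega> \<T> \<and> F v = r" for v
    by (simp add: predictor_iff[OF m] F_def r_def[abs_def])
  have "\<exists>f. F f = r"
  proof (rule finite_support_surj[OF finite_nodes])
    show "f = (\<lambda>_. 0)" if "\<And>x. x \<notin> nodes \<T> \<Longrightarrow> f x = 0" "F f = (\<lambda>_. 0)" for f
      using that inj by blast
  qed (auto simp: F_def r_def predictor_op_add predictor_op_scale, auto simp: predictor_op_def)
  then obtain f where f: "F f = r" by blast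
  \<comment> \<open>The operator sees only nodal values, so the nodal solution \<open>f\<close> may
    be replaced by its interpolant, which lies in the finite element space.\<close>
  have "F (interp f) = F f"
    by (auto simp: F_def predictor_op_def fun_eq_iff interp_node interp_id interp_in)
  with f have "predictor \<Omega> \<T> \<alpha> l_ex \<theta> k m (interp f)"
    by (simp add: iff interp_in)
  moreover have "v = w" if "predictor \<Omega> \<T> \<alpha> l_ex \<theta> k m v" "predictor \<Omega> \<T> \<alpha> l_ex \<theta> k m w" for v w
  proof (rule S1_vec_eqI)
    \<comment> \<open>The difference of two solutions solves the homogeneous equation; it is written
      with the factor -1 so that additivity and homogeneity apply.\<close>
    have "F (\<lambda>x. v x + (- 1) *\<^sub>R w x) = (\<lambda>x. F v x + (- 1) *\<^sub>R F w x)"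
      by (simp only: F_def predictor_op_add predictor_op_scale)
    then have "F (\<lambda>x. v x + (- 1) *\<^sub>R w x) = (\<lambda>_. 0)"
      using that by (simp add: iff)
    then show "v z = w z" if "z \<in> nodes \<T>" for z
      using inj that by fastforce
  qed (use that iff in auto)
  ultimately show ?thesis by blast
qed

subsection \<open>Corrector\<close>

text \<open>The midpoint occurs linearly as the left factor of both cross products, so everything
  else can be collected in \<open>g\<close>, which does not involve \<open>m'\<close>. In its
  constant, \<open>k\<close> comes from the difference quotient, 2 from the midpoint and
  \<open>1 + \<alpha>\<^sup>2\<close> from the left-hand side.\<close>

lemma corrector_iff:
  fixes m v :: "real^3 \<Rightarrow> real^3" and k \<alpha> l_ex :: real
  assumes "k > 0"
  defines "p \<equiv> \<lambda>x. m x + (k / 2) *\<^sub>R v x"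
  defines "g \<equiv> \<lambda>z. (- (k * l_ex\<^sup>2 / (2 * (1 + \<alpha>\<^sup>2)))) *\<^sub>R
    (laplacian p z + \<alpha> *\<^sub>R (p z \<times> laplacian p z))"
  shows "corrector \<Omega> \<T> \<alpha> l_ex k m v m' \<longleftrightarrow> m' \<in> M_h \<Omega> \<T> \<and>
    (\<forall>z\<in>nodes \<T>. m' z - m z = (m' z + m z) \<times> g z)"
proof -
  let ?H = "laplacian p" and ?a = "1 + \<alpha>\<^sup>2"
  have a: "?a > 0" by (simp add: add_pos_nonneg)
  define d where "d z = (m' z - m z) /\<^sub>R k" for z
  define X where "X z = ((m' z + m z) /\<^sub>R 2) \<times> ?H z" for z
  define Y where "Y z = ((m' z + m z) /\<^sub>R 2) \<times> (p z \<times> ?H z)" for z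
  have "corrector \<Omega> \<T> \<alpha> l_ex k m v m' \<longleftrightarrow> m' \<in> M_h \<Omega> \<T> \<and>
    (\<forall>w\<in>S1_vec \<Omega> \<T>. ?a * lumped \<Omega> \<T> d w =
      - l_ex\<^sup>2 * lumped \<Omega> \<T> X w - \<alpha> * l_ex\<^sup>2 * lumped \<Omega> \<T> Y w)"
    unfolding corrector_def Let_def d_def[abs_def] X_def[abs_def] Y_def[abs_def] p_def ..
  also have "\<dots> \<longleftrightarrow> m' \<in> M_h \<Omega> \<T> \<and>
    (\<forall>w\<in>S1_vec \<Omega> \<T>. lumped \<Omega> \<T> (\<lambda>z. ?a *\<^sub>R d z) w =
      lumped \<Omega> \<T> (\<lambda>z. (- l_ex\<^sup>2) *\<^sub>R X z - (\<alpha> * l_ex\<^sup>2) *\<^sub>R Y z) w)"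
    by (simp only: lumped_diff_left lumped_scale_left)
  also have "\<dots> \<longleftrightarrow> m' \<in> M_h \<Omega> \<T> \<and> (\<forall>z\<in>nodes \<T>. ?a *\<^sub>R ((m' z - m z) /\<^sub>R k) =
      (- l_ex\<^sup>2) *\<^sub>R (((m' z + m z) /\<^sub>R 2) \<times> ?H z)
        - (\<alpha> * l_ex\<^sup>2) *\<^sub>R (((m' z + m z) /\<^sub>R 2) \<times> (p z \<times> ?H z)))"
    unfolding lumped_eq_iff d_def X_def Y_def ..
  also have "\<dots> \<longleftrightarrow> m' \<in> M_h \<Omega> \<T> \<and> (\<forall>z\<in>nodes \<T>. m' z - m z = (m' z + m z) \<times> g z)"
  proof -
    have "?a *\<^sub>R ((m' z - m z) /\<^sub>R k) =
      (- l_ex\<^sup>2) *\<^sub>R (((m' z + m z) /\<^sub>R 2) \<times> ?H z)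
        - (\<alpha> * l_ex\<^sup>2) *\<^sub>R (((m' z + m z) /\<^sub>R 2) \<times> (p z \<times> ?H z)) \<longleftrightarrow>
      m' z - m z = (m' z + m z) \<times> g z" for z
    proof -
      have 1: "(- l_ex\<^sup>2) *\<^sub>R ((q /\<^sub>R 2) \<times> G) - (\<alpha> * l_ex\<^sup>2) *\<^sub>R ((q /\<^sub>R 2) \<times> N) =
        (- (l_ex\<^sup>2 / 2)) *\<^sub>R (q \<times> (G + \<alpha> *\<^sub>R N))" for q G N
        by (simp add: cross_add_right cross_mult_right cross_mult_left scaleR_add_right mult_ac)
      have "- (k * l_ex\<^sup>2 / (2 * ?a)) = k / ?a * - (l_ex\<^sup>2 / 2)" by simp
      then have 2: "q \<times> g z = (k / ?a) *\<^sub>R (- (l_ex\<^sup>2 / 2)) *\<^sub>R (q \<times> (?H z + \<alpha> *\<^sub>R (p z \<times> ?H z)))" for q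
        by (simp only: g_def cross_mult_right scaleR_scaleR)
      have "a *\<^sub>R (x /\<^sub>R k) = y \<longleftrightarrow> x = (k / a) *\<^sub>R y" if "a > 0" for a and x y :: "real^3"
        using that assms(1) by (auto simp: vec_eq_iff field_simps)
      from this[OF a] show ?thesis unfolding 1 2 .
    qed
    then show ?thesis by blast
  qed
  finally show ?thesis .
qed

text \<open>The Cayley equation is solved at each node and the values are interpolated; uniqueness
  at the nodes gives uniqueness of the function.\<close>

lemma corrector_ex1:
  assumes m: "m \<in> M_h \<Omega> \<T>" and "k > 0"
  shows "\<exists>!m'. corrector \<Omega> \<T> \<alpha> l_ex k m v m'"
proof -
  obtain g where iff: "\<And>m'. corrector \<Omega> \<T> \<alpha> l_ex k m v m' \<longleftrightarrow> m' \<in> M_h \<Omega> \<T> \<and>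
    (\<forall>z\<in>nodes \<T>. m' z - m z = (m' z + m z) \<times> g z)"
    by (rule that, rule corrector_iff[OF \<open>k > 0\<close>])
  have "\<forall>z. \<exists>y. y - m z = (y + m z) \<times> g z" using cayley_ex1 by blast
  then obtain y where y: "\<And>z. y z - m z = (y z + m z) \<times> g z" by metis
  \<comment> \<open>The unit length constraint is inherited from \<open>m\<close>, because the
    Cayley transform preserves norms.\<close>
  have "norm (y z) = 1" if "z \<in> nodes \<T>" for z
    using norm_cayley[OF y[of z]] m that by (simp add: M_h_def)
  then have "corrector \<Omega> \<T> \<alpha> l_ex k m v (interp y)"
    unfolding iff by (simp add: M_h_def interp_in interp_node y)
  moreover have "m' = m''" if "corrector \<Omega> \<T> \<alpha> l_ex k m v m'" "corrector \<Omega> \<T> \<alpha> l_ex k m v m''" for m' m''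
  proof (rule S1_vec_eqI)
    show "m' z = m'' z" if z: "z \<in> nodes \<T>" for z
    proof -
      have "m' z - m z = (m' z + m z) \<times> g z" "m'' z - m z = (m'' z + m z) \<times> g z"
        using \<open>corrector _ _ _ _ _ _ _ m'\<close> \<open>corrector _ _ _ _ _ _ _ m''\<close> z unfolding iff by blast+
      then show ?thesis using cayley_ex1 by blast
    qed
  qed (use that iff in \<open>auto simp: M_h_def\<close>)
  ultimately show ?thesis by blast
qed

section \<open>Iterating the time step\<close>

lemma PC2_steps_in_M_h:
  assumes "PC2_steps \<Omega> \<T> \<alpha> l_ex \<theta> k m0 n m v" "m0 \<in> M_h \<Omega> \<T>"
  shows "m n \<in> M_h \<Omega> \<T>"
  using assms by (cases n) (auto simp: PC2_steps_def corrector_def)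

end

theorem theorem4p3:
  fixes \<Omega> :: "(real^3) set" and \<T> :: "(real^3) set set"
    and h t_end k \<alpha> l_ex \<theta> :: real and L :: nat
    and m0 :: "real^3 \<Rightarrow> real^3"
  assumes "lipschitz_domain \<Omega>" and "bounded \<Omega>"
    and "tetrahedral_triangulation \<Omega> \<T>" and "h = mesh_size \<T>" and "h > 0"
    and "t_end > 0" and "L > 0" and "k = t_end / real L"
    and "\<alpha> > 0" and "l_ex > 0" and "0 \<le> \<theta>" and "\<theta> \<le> 1"
    and "m0 \<in> M_h \<Omega> \<T>"
  shows "\<forall>l<L. \<forall>m v. PC2_steps \<Omega> \<T> \<alpha> l_ex \<theta> k m0 l m v \<longrightarrow>
           (\<exists>!v\<^sub>h. predictor \<Omega> \<T> \<alpha> l_ex \<theta> k (m l) v\<^sub>h) \<and>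
           (\<forall>v\<^sub>h. predictor \<Omega> \<T> \<alpha> l_ex \<theta> k (m l) v\<^sub>h \<longrightarrow>
              (\<exists>!m\<^sub>h. corrector \<Omega> \<T> \<alpha> l_ex k (m l) v\<^sub>h m\<^sub>h))"
proof (intro allI impI conjI)
  interpret tetrahedral_mesh \<Omega> \<T>
    using assms(1-3) by unfold_locales (simp_all add: lipschitz_domain_def)
  have "k > 0" using assms by simp
  fix l m v assume "PC2_steps \<Omega> \<T> \<alpha> l_ex \<theta> k m0 l m v"
  \<comment> \<open>Membership of the current iterate supplies both the finite element function
    needed by the predictor and the nodal unit length needed by the corrector.\<close>
  then have m: "m l \<in> M_h \<Omega> \<T>" using PC2_steps_in_M_h assms by blast
  then show "\<exists>!v\<^sub>h. predictor \<Omega> \<T> \<alpha> l_ex \<theta> k (m l) v\<^sub>h"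
    using assms \<open>k > 0\<close> by (intro predictor_ex1) (auto simp: M_h_def)
  show "\<exists>!m\<^sub>h. corrector \<Omega> \<T> \<alpha> l_ex k (m l) v\<^sub>h m\<^sub>h" for v\<^sub>h
    by (rule corrector_ex1[OF m \<open>k > 0\<close>])
qed

end
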